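(* Let $X$ be a set and let $\mathscr{A}$ and $\mathscr{B}$ be collections of families of subsets of $X$. Then $X$ satisfies the principle $\mathbf{SCS}_1(\mathscr{A},\mathscr{B})$ if and only if $X$ satisfies the principle $\mathbf{SDS}_1(\mathscr{A}^c,\mathscr{B}^c)$.
   Context: For $U\subseteq X$, $U^c=X\setminus U$; for a family $\mathcal{U}$ of subsets of $X$, $\mathcal{U}^c=\{U^c:U\in\mathcal{U}\}$; for a collection $\mathscr{U}$ of families of subsets of $X$, $\mathscr{U}^c=\{\mathcal{U}^c:\mathcal{U}\in\mathscr{U}\}$. For a set $Y$, $[Y]^{<\omega}$ is the collection of all finite subsets of $Y$ (including $\emptyset$). For the empty family of subsets of $X$, $\bigcup\emptyset=\emptyset$ and $\bigcap\emptyset=X$. For collections $\mathscr{A},\mathscr{B}$ of families of subsets of $X$: $\mathbf{SCS}_1(\mathscr{A},\mathscr{B})$: for any sequence $\{\mathcal{U}_n:n\in\omega\}$ of elements of $\mathscr{A}$ there is a sequence $\{x_n:n\in\omega\}$ of elements of $X$ such that $\bigcup\{\mathcal{V}_n:n\in\omega\}\in\mathscr{B}$, where $\mathcal{V}_n=\{\bigcup\mathcal{V}:\mathcal{V}\in[\mathcal{U}_n]^{<\omega}\text{ and }x_n\in V\text{ for each }V\in\mathcal{V}\}$. $\mathbf{SDS}_1(\mathscr{A},\mathscr{B})$: for any sequence $\{\mathcal{D}_n:n\in\omega\}$ of elements of $\mathscr{A}$ there is a sequence $\{x_n:n\in\omega\}$ of elements of $X$ such that $\bigcup\{\mathcal{F}_n:n\in\omega\}\in\mathscr{B}$,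 where $\mathcal{F}_n=\{\bigcap\mathcal{F}:\mathcal{F}\in[\mathcal{D}_n]^{<\omega}\text{ and }x_n\in E^c\text{ for each }E\in\mathcal{F}\}$. *)

theory Defs
  imports Main
begin

definition compl_fam :: "'a set \<Rightarrow> 'a set set \<Rightarrow> 'a set set" where
  "compl_fam X \<U> = {X - U | U. U \<in> \<U>}"

definition compl_coll :: "'a set \<Rightarrow> 'a set set set \<Rightarrow> 'a set set set" where
  "compl_coll X \<A> = {compl_fam X \<U> | \<U>. \<U> \<in> \<A>}"

text \<open>Intersection of a family of subsets of X; the intersection of the empty family is X,
  not the whole type.\<close>

definition Inter_in :: "'a set \<Rightarrow> 'a set set \<Rightarrow> 'a set" where
  "Inter_in X \<F> = X \<inter> \<Inter>\<F>"

definition SCS1 :: "'a set \<Rightarrow> 'a set set set \<Rightarrow> 'a set set set \<Rightarrow> bool" where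
  "SCS1 X \<A> \<B> \<longleftrightarrow>
    (\<forall>\<U> :: nat \<Rightarrow> 'a set set. (\<forall>n. \<U> n \<in> \<A>) \<longrightarrow>
      (\<exists>x :: nat \<Rightarrow> 'a. (\<forall>n. x n \<in> X) \<and>
        (\<Union>n. {\<Union>\<V> | \<V>. finite \<V> \<and> \<V> \<subseteq> \<U> n \<and> (\<forall>V\<in>\<V>. x n \<in> V)}) \<in> \<B>))"

definition SDS1 :: "'a set \<Rightarrow> 'a set set set \<Rightarrow> 'a set set set \<Rightarrow> bool" where
  "SDS1 X \<A> \<B> \<longleftrightarrow>
    (\<forall>\<D> :: nat \<Rightarrow> 'a set set. (\<forall>n. \<D> n \<in> \<A>) \<longrightarrow>
      (\<exists>x :: nat \<Rightarrow> 'a. (\<forall>n. x n \<in> X) \<and>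
        (\<Union>n. {Inter_in X \<F> | \<F>. finite \<F> \<and> \<F> \<subseteq> \<D> n \<and> (\<forall>E\<in>\<F>. x n \<in> X - E)}) \<in> \<B>))"

end

theory Submission
  imports Defs
begin

text \<open>Complementation \<open>U \<mapsto> X - U\<close> is an involution on the subsets of \<open>X\<close>, hence it induces
  an involution on the families of subsets of \<open>X\<close> (\<open>compl_fam_compl_fam\<close>). By
  De Morgan, it turns the unions of finite subfamilies of \<open>\<U>\<close> whose members all contain \<open>x\<close>
  into the intersections of finite subfamilies of the family of complements whose members all
  miss \<open>x\<close> (\<open>inters_missing_compl_fam\<close>); the empty subfamily fits in, since \<open>X - \<Union>{} = X\<close> is the
  intersection of the empty family. So a sequence of points answers a sequence in \<open>\<A>\<close> for the
  first principle exactly when the same points answer the sequence of complementary families for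
  the second one (\<open>answer_compl_iff\<close>), and all sequences in the complementary collection arise
  in this way.\<close>

text \<open>The unions of finite subfamilies of \<open>\<U>\<close> all of whose members contain \<open>x\<close>.\<close>

definition unions_containing :: "'a set set \<Rightarrow> 'a \<Rightarrow> 'a set set" where
  "unions_containing \<U> x = {\<Union>\<V> | \<V>. finite \<V> \<and> \<V> \<subseteq> \<U> \<and> (\<forall>V\<in>\<V>. x \<in> V)}"

text \<open>The intersections in \<open>X\<close> of finite subfamilies of \<open>\<D>\<close> all of whose members miss \<open>x\<close>.\<close>

definition inters_missing :: "'a set \<Rightarrow> 'a set set \<Rightarrow> 'a \<Rightarrow> 'a set set" where
  "inters_missing X \<D> x =
    {Inter_in X \<F> | \<F>. finite \<F> \<and> \<F> \<subseteq> \<D> \<and> (\<forall>E\<in>\<F>. x \<in> X - E)}"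

lemma compl_fam_eq_image: "compl_fam X \<U> = (\<lambda>U. X - U) ` \<U>"
  unfolding compl_fam_def by auto

lemma compl_fam_compl_fam:
  assumes "\<U> \<subseteq> Pow X"
  shows "compl_fam X (compl_fam X \<U>) = \<U>"
proof -
  have "(\<lambda>U. X - (X - U)) ` \<U> = (\<lambda>U. U) ` \<U>"
    using assms by (intro image_cong) auto
  then show ?thesis
    by (simp add: compl_fam_eq_image image_image)
qed

lemma compl_fam_mem_compl_coll_iff:
  assumes "\<B> \<subseteq> Pow (Pow X)" and "\<U> \<subseteq> Pow X"
  shows "compl_fam X \<U> \<in> compl_coll X \<B> \<longleftrightarrow> \<U> \<in> \<B>"
proof
  assume "compl_fam X \<U> \<in> compl_coll X \<B>"
  then obtain \<W> where "\<W> \<in> \<B>" "compl_fam X \<U> = compl_fam X \<W>"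
    unfolding compl_coll_def by auto
  moreover have "\<W> \<subseteq> Pow X"
    using assms(1) \<open>\<W> \<in> \<B>\<close> by blast
  ultimately show "\<U> \<in> \<B>"
    using compl_fam_compl_fam assms(2) by metis
qed (auto simp: compl_coll_def)

lemma Inter_in_compl_fam: "Inter_in X (compl_fam X \<V>) = X - \<Union>\<V>"
  unfolding Inter_in_def compl_fam_eq_image by auto

lemma inters_missing_compl_fam:
  assumes "\<U> \<subseteq> Pow X" and "x \<in> X"
  shows "inters_missing X (compl_fam X \<U>) x = compl_fam X (unions_containing \<U> x)"
proof (intro equalityI subsetI)
  fix S assume "S \<in> inters_missing X (compl_fam X \<U>) x"
  then obtain \<F> where \<F>: "S = Inter_in X \<F>" "finite \<F>" "\<F> \<subseteq> (\<lambda>U. X - U) ` \<U>"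
      "\<forall>E\<in>\<F>. x \<in> X - E"
    unfolding inters_missing_def compl_fam_eq_image by auto
  then obtain \<V> where \<V>: "\<V> \<subseteq> \<U>" "finite \<V>" "\<F> = compl_fam X \<V>"
    by (metis compl_fam_eq_image finite_subset_image)
  have "\<forall>V\<in>\<V>. x \<in> V"
    using \<F>(4) \<V>(3) by (auto simp: compl_fam_eq_image)
  then have "\<Union>\<V> \<in> unions_containing \<U> x"
    using \<V> unfolding unions_containing_def by auto
  moreover have "S = X - \<Union>\<V>"
    unfolding \<F>(1) \<V>(3) by (rule Inter_in_compl_fam)
  ultimately show "S \<in> compl_fam X (unions_containing \<U> x)"
    unfolding compl_fam_def by blast
next
  fix S assume "S \<in> compl_fam X (unions_containing \<U> x)"
  then obtain \<V> where \<V>: "S = X - \<Union>\<V>" "finite \<V>" "\<V> \<subseteq> \<U>" "\<forall>V\<in>\<V>. x \<in> V"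
    unfolding compl_fam_def unions_containing_def by auto
  have "finite (compl_fam X \<V>)" "compl_fam X \<V> \<subseteq> compl_fam X \<U>"
      "\<forall>E\<in>compl_fam X \<V>. x \<in> X - E"
    using \<V> assms(2) by (auto simp: compl_fam_eq_image)
  then show "S \<in> inters_missing X (compl_fam X \<U>) x"
    unfolding inters_missing_def \<V>(1) Inter_in_compl_fam [symmetric] by blast
qed

lemma answer_compl_iff:
  assumes "\<B> \<subseteq> Pow (Pow X)" and "\<And>n. \<U> n \<subseteq> Pow X" and "\<And>n. x n \<in> X"
  shows "(\<Union>n. inters_missing X (compl_fam X (\<U> n)) (x n)) \<in> compl_coll X \<B> \<longleftrightarrow>
    (\<Union>n. unions_containing (\<U> n) (x n)) \<in> \<B>"
proof -
  have "(\<Union>n. inters_missing X (compl_fam X (\<U> n)) (x n)) =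
      compl_fam X (\<Union>n. unions_containing (\<U> n) (x n))"
    unfolding inters_missing_compl_fam [OF assms(2,3)] by (simp add: compl_fam_eq_image image_UN)
  moreover have "(\<Union>n. unions_containing (\<U> n) (x n)) \<subseteq> Pow X"
    using assms(2) unfolding unions_containing_def by blast
  ultimately show ?thesis
    using compl_fam_mem_compl_coll_iff assms(1) by metis
qed

theorem theorem3p8:
  fixes X :: "'a set" and \<A> \<B> :: "'a set set set"
  assumes "\<A> \<subseteq> Pow (Pow X)" and "\<B> \<subseteq> Pow (Pow X)"
  shows "SCS1 X \<A> \<B> \<longleftrightarrow> SDS1 X (compl_coll X \<A>) (compl_coll X \<B>)"
proof
  assume scs: "SCS1 X \<A> \<B>"
  show "SDS1 X (compl_coll X \<A>) (compl_coll X \<B>)"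
    unfolding SDS1_def inters_missing_def [symmetric]
  proof (intro allI impI)
    fix \<D> :: "nat \<Rightarrow> 'a set set"
    assume "\<forall>n. \<D> n \<in> compl_coll X \<A>"
    then have "\<forall>n. \<exists>\<U>. \<U> \<in> \<A> \<and> \<D> n = compl_fam X \<U>"
      unfolding compl_coll_def by blast
    then obtain \<U> where \<U>: "\<And>n. \<U> n \<in> \<A>" "\<And>n. \<D> n = compl_fam X (\<U> n)"
      by metis
    obtain x where x: "\<And>n. x n \<in> X" "(\<Union>n. unions_containing (\<U> n) (x n)) \<in> \<B>"
      using scs \<U>(1) unfolding SCS1_def unions_containing_def [symmetric] by blast
    have "\<And>n. \<U> n \<subseteq> Pow X"
      using assms(1) \<U>(1) by blast
    then have "(\<Union>n. inters_missing X (\<D> n) (x n)) \<in> compl_coll X \<B>"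
      unfolding \<U>(2) using answer_compl_iff assms(2) x by blast
    then show "\<exists>x. (\<forall>n. x n \<in> X) \<and> (\<Union>n. inters_missing X (\<D> n) (x n)) \<in> compl_coll X \<B>"
      using x(1) by blast
  qed
next
  assume sds: "SDS1 X (compl_coll X \<A>) (compl_coll X \<B>)"
  show "SCS1 X \<A> \<B>"
    unfolding SCS1_def unions_containing_def [symmetric]
  proof (intro allI impI)
    fix \<U> :: "nat \<Rightarrow> 'a set set"
    assume \<U>: "\<forall>n. \<U> n \<in> \<A>"
    then have "\<forall>n. compl_fam X (\<U> n) \<in> compl_coll X \<A>"
      unfolding compl_coll_def by blast
    then obtain x where x: "\<And>n. x n \<in> X"
        "(\<Union>n. inters_missing X (compl_fam X (\<U> n)) (x n)) \<in> compl_coll X \<B>"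
      using sds [unfolded SDS1_def inters_missing_def [symmetric],
          rule_format, of "\<lambda>n. compl_fam X (\<U> n)"] by blast
    have "\<And>n. \<U> n \<subseteq> Pow X"
      using assms(1) \<U> by blast
    then have "(\<Union>n. unions_containing (\<U> n) (x n)) \<in> \<B>"
      using answer_compl_iff assms(2) x by blast
    then show "\<exists>x. (\<forall>n. x n \<in> X) \<and> (\<Union>n. unions_containing (\<U> n) (x n)) \<in> \<B>"
      using x(1) by blast
  qed
qed

end
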